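(* Let $\Gamma$ be a countable discrete group, let $S=S^{-1}$ be a symmetric (possibly infinite) generating set of $\Gamma$, and let $w:S\to[0,\infty)$ be a weight function. Then $$\|x\|_w=\inf\Big\{\sum_{i=1}^n w(s_i)\ \Big|\ x=s_1s_2\cdots s_n,\ s_i\in S\Big\}$$ (with the empty product, $n=0$, allowed for $x=e$) defines a proper norm on $\Gamma$.
   Context: A weight function on a symmetric generating set $S$ is a function $w:S\to[0,\infty)$ that is positive ($w(s)>0$ for all $s\in S$), proper (for every $r\ge 0$ the set $\{s\in S\mid w(s)\le r\}$ is finite), and satisfies $w(s^{-1})=w(s)$ for all $s\in S$. A norm on a group $\Gamma$ is a map $\|\cdot\|:\Gamma\to[0,\infty)$ such that (1) $\|x\|=0$ if and only if $x=e$; (2) $\|x^{-1}\|=\|x\|$ for all $x$; (3) $\|xy\|\le\|x\|+\|y\|$ for all $x,y$. A norm determines the left invariant metric $d(x,y)=\|x^{-1}y\|$. A norm is proper if it is proper as a map $\Gamma\to[0,\infty)$ (preimages of compact sets are compact), where $\Gamma$ carries the topology induced by this metric. *)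

theory Defs
  imports "HOL-Analysis.Analysis" "HOL-Algebra.Generated_Groups"
begin

text \<open>Functions on \<open>S\<close> or on a group are total HOL functions; all conditions constrain them
  only on \<open>S\<close>, respectively on the carrier.\<close>

definition weight_function ::
    "('a, 'b) monoid_scheme \<Rightarrow> 'a set \<Rightarrow> ('a \<Rightarrow> real) \<Rightarrow> bool" where
  "weight_function G S w \<longleftrightarrow>
     w \<in> S \<rightarrow> {0..} \<and>
     (\<forall>s\<in>S. w s > 0) \<and>
     (\<forall>r\<ge>0. finite {s \<in> S. w s \<le> r}) \<and>
     (\<forall>s\<in>S. w (inv\<^bsub>G\<^esub> s) = w s)"

definition group_norm :: "('a, 'b) monoid_scheme \<Rightarrow> ('a \<Rightarrow> real) \<Rightarrow> bool" where
  "group_norm G N \<longleftrightarrow>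
     N \<in> carrier G \<rightarrow> {0..} \<and>
     (\<forall>x\<in>carrier G. N x = 0 \<longleftrightarrow> x = \<one>\<^bsub>G\<^esub>) \<and>
     (\<forall>x\<in>carrier G. N (inv\<^bsub>G\<^esub> x) = N x) \<and>
     (\<forall>x\<in>carrier G. \<forall>y\<in>carrier G. N (x \<otimes>\<^bsub>G\<^esub> y) \<le> N x + N y)"

text \<open>Outside the carrier the distance is set to \<open>0\<close>, because the locale
  \<open>Metric_space\<close> requires nonnegativity and symmetry on the whole type.\<close>

definition norm_dist :: "('a, 'b) monoid_scheme \<Rightarrow> ('a \<Rightarrow> real) \<Rightarrow> 'a \<Rightarrow> 'a \<Rightarrow> real" where
  "norm_dist G N x y =
     (if x \<in> carrier G \<and> y \<in> carrier G then N (inv\<^bsub>G\<^esub> x \<otimes>\<^bsub>G\<^esub> y) else 0)"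

text \<open>The library's \<open>proper_map\<close> asks for a closed map with compact fibres; here properness
  means that preimages of compact subsets of \<open>[0,\<infinity>)\<close> are compact.\<close>

definition proper_group_norm :: "('a, 'b) monoid_scheme \<Rightarrow> ('a \<Rightarrow> real) \<Rightarrow> bool" where
  "proper_group_norm G N \<longleftrightarrow>
     group_norm G N \<and>
     (\<forall>K. compact K \<and> K \<subseteq> {0..} \<longrightarrow>
        compactin (Metric_space.mtopology (carrier G) (norm_dist G N)) {x \<in> carrier G. N x \<in> K})"

text \<open>\<open>Inf\<close> is the infimum in the reals. The set is bounded below by \<open>0\<close> when \<open>w\<close> is
  nonnegative on \<open>S\<close>, and nonempty for each \<open>x\<close> in the carrier when \<open>S\<close> is a symmetric generating
  set; the empty list is the empty product.\<close>

definition weighted_word_norm ::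
    "('a, 'b) monoid_scheme \<Rightarrow> 'a set \<Rightarrow> ('a \<Rightarrow> real) \<Rightarrow> 'a \<Rightarrow> real" where
  "weighted_word_norm G S w x =
     Inf {sum_list (map w ss) | ss. set ss \<subseteq> S \<and> x = foldr (\<otimes>\<^bsub>G\<^esub>) ss \<one>\<^bsub>G\<^esub>}"

end

theory Submission
  imports Defs
begin

text \<open>Properness and positivity of the weight together bound it below by some \<open>\<delta> > 0\<close>: only
  finitely many generators have weight at most \<open>1\<close>, and each of these has positive weight.
  Both nontrivial claims rest on this. A nonempty word costs at least \<open>\<delta>\<close>, so an element
  with norm below \<open>\<delta>\<close> is spelled by the empty word and is the identity. A word of cost
  at most \<open>r\<close> has at most \<open>r / \<delta>\<close> letters, all of them from the finite set of generators of
  weight at most \<open>r\<close>, so there are finitely many such words and the norm has finite balls.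
  Subadditivity comes from concatenating words, and symmetry from reversing a word
  and inverting its letters.

  Preimages of compact sets lie in balls, hence are finite, and a finite set of points is compact
  in any topology on the group, in particular in the one induced by the norm.\<close>

section \<open>Norms whose balls are finite\<close>

context group
begin

lemma Metric_space_norm_dist:
  assumes "group_norm G N"
  shows "Metric_space (carrier G) (norm_dist G N)"
proof
  have nonneg: "0 \<le> N x" if "x \<in> carrier G" for x
    using assms that by (auto simp: group_norm_def)
  have zero: "N x = 0 \<longleftrightarrow> x = \<one>" if "x \<in> carrier G" for x
    using assms that by (auto simp: group_norm_def)
  have inv: "N (inv x) = N x" if "x \<in> carrier G" for x
    using assms that by (auto simp: group_norm_def)
  have triangle: "N (x \<otimes> y) \<le> N x + N y" if "x \<in> carrier G" "y \<in> carrier G" for x y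
    using assms that by (auto simp: group_norm_def)
  show "0 \<le> norm_dist G N x y" for x y
    by (simp add: norm_dist_def nonneg)
  show "norm_dist G N x y = norm_dist G N y x" for x y
  proof (cases "x \<in> carrier G \<and> y \<in> carrier G")
    case True
    then have "inv (inv x \<otimes> y) = inv y \<otimes> x"
      by (simp add: inv_mult_group)
    then show ?thesis
      using True inv[of "inv x \<otimes> y"] by (simp add: norm_dist_def)
  qed (auto simp: norm_dist_def)
  show "norm_dist G N x y = 0 \<longleftrightarrow> x = y" if "x \<in> carrier G" "y \<in> carrier G" for x y
    using that zero[of "inv x \<otimes> y"] by (auto simp: norm_dist_def inv_solve_left')
  show "norm_dist G N x z \<le> norm_dist G N x y + norm_dist G N y z"
    if "x \<in> carrier G" "y \<in> carrier G" "z \<in> carrier G" for x y z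
  proof -
    have "y \<otimes> (inv y \<otimes> z) = z"
      using that by (simp flip: m_assoc)
    then have "inv x \<otimes> z = (inv x \<otimes> y) \<otimes> (inv y \<otimes> z)"
      using that by (simp add: m_assoc)
    then show ?thesis
      using that triangle[of "inv x \<otimes> y" "inv y \<otimes> z"] by (simp add: norm_dist_def)
  qed
qed

lemma proper_group_normI_finite_balls:
  assumes norm: "group_norm G N"
    and balls: "\<And>r. finite {x \<in> carrier G. N x \<le> r}"
  shows "proper_group_norm G N"
  unfolding proper_group_norm_def
proof (intro conjI allI impI norm)
  interpret Metric_space "carrier G" "norm_dist G N"
    by (rule Metric_space_norm_dist[OF norm])
  fix K :: "real set" assume "compact K \<and> K \<subseteq> {0..}"
  then have "bdd_above K"
    by (simp add: bounded_imp_bdd_above compact_imp_bounded)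
  then obtain r where "\<forall>k\<in>K. k \<le> r"
    unfolding bdd_above_def by blast
  then have "{x \<in> carrier G. N x \<in> K} \<subseteq> {x \<in> carrier G. N x \<le> r}"
    by blast
  then have "finite {x \<in> carrier G. N x \<in> K}"
    by (rule finite_subset) (rule balls)
  then show "compactin mtopology {x \<in> carrier G. N x \<in> K}"
    by (intro finite_imp_compactin) auto
qed

section \<open>Products of words\<close>

abbreviation word_prod :: "'a list \<Rightarrow> 'a" where
  "word_prod ss \<equiv> foldr (\<otimes>) ss \<one>"

lemma word_prod_closed [simp]:
  "set ss \<subseteq> carrier G \<Longrightarrow> word_prod ss \<in> carrier G"
  by (induction ss) auto

lemma word_prod_append:
  "set ss \<subseteq> carrier G \<Longrightarrow> set ts \<subseteq> carrier G \<Longrightarrow>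
    word_prod (ss @ ts) = word_prod ss \<otimes> word_prod ts"
  by (induction ss) (auto simp: m_assoc simp del: foldr_append)

lemma word_prod_rev_inv:
  "set ss \<subseteq> carrier G \<Longrightarrow> word_prod (rev (map (m_inv G) ss)) = inv (word_prod ss)"
proof (induction ss)
  case (Cons s ss)
  have "word_prod (rev (map (m_inv G) (s # ss))) =
      word_prod (rev (map (m_inv G) ss)) \<otimes> word_prod [inv s]"
    using Cons.prems by (simp only: rev.simps list.map, intro word_prod_append) auto
  with Cons show ?case
    by (simp add: inv_mult_group del: foldr_append)
qed simp

end

section \<open>The weighted word norm\<close>

locale weighted_group = group G for G (structure) +
  fixes S :: "'a set" and w :: "'a \<Rightarrow> real"
  assumes S_carrier: "S \<subseteq> carrier G"
    and S_sym: "set_inv S = S"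
    and S_generates: "generate G S = carrier G"
    and weight: "weight_function G S w"
begin

abbreviation cost :: "'a list \<Rightarrow> real" where
  "cost ss \<equiv> sum_list (map w ss)"

lemma inv_in_S: "s \<in> S \<Longrightarrow> inv s \<in> S"
  using S_sym by (auto simp: SET_INV_def)

lemma weight_pos: "s \<in> S \<Longrightarrow> 0 < w s"
  using weight by (simp add: weight_function_def)

lemma weight_inv: "s \<in> S \<Longrightarrow> w (inv s) = w s"
  using weight by (simp add: weight_function_def)

lemma finite_weight_le: "finite {s \<in> S. w s \<le> r}"
proof -
  have "finite {s \<in> S. w s \<le> max r 0}"
    using weight by (simp add: weight_function_def)
  then show ?thesis
    by (rule rev_finite_subset) auto
qed

lemma cost_nonneg: "set ss \<subseteq> S \<Longrightarrow> 0 \<le> cost ss"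
  by (intro sum_list_nonneg) (auto intro: less_imp_le weight_pos)

lemma weight_le_cost: "set ss \<subseteq> S \<Longrightarrow> s \<in> set ss \<Longrightarrow> w s \<le> cost ss"
  by (rule member_le_sum_list) (auto intro: less_imp_le weight_pos)

lemma weight_bounded_below:
  obtains \<delta> where "\<delta> > 0" "\<And>s. s \<in> S \<Longrightarrow> \<delta> \<le> w s"
proof
  \<comment> \<open>The value \<open>1\<close> serves the generators of weight above \<open>1\<close> and keeps the set nonempty.\<close>
  let ?W = "insert 1 (w ` {s \<in> S. w s \<le> 1})"
  have fin: "finite ?W"
    using finite_weight_le by simp
  then show "Min ?W > 0"
    by (subst Min_gr_iff) (auto intro: weight_pos)
  show "Min ?W \<le> w s" if "s \<in> S" for s
  proof (cases "w s \<le> 1")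
    case True
    then show ?thesis
      using fin that by (intro Min_le) auto
  next
    case False
    moreover have "Min ?W \<le> 1"
      using fin by (intro Min_le) auto
    ultimately show ?thesis by linarith
  qed
qed

lemma length_le_cost:
  assumes "\<And>s. s \<in> S \<Longrightarrow> \<delta> \<le> w s" "set ss \<subseteq> S"
  shows "real (length ss) * \<delta> \<le> cost ss"
  using assms(2) by (induction ss) (auto simp: algebra_simps intro: add_mono assms(1))

lemma finite_words_cost_le: "finite {ss. set ss \<subseteq> S \<and> cost ss \<le> r}"
proof -
  obtain \<delta> where \<delta>: "\<delta> > 0" "\<And>s. s \<in> S \<Longrightarrow> \<delta> \<le> w s"
    using weight_bounded_below by blast
  have "{ss. set ss \<subseteq> S \<and> cost ss \<le> r} \<subseteq>
      {ss. set ss \<subseteq> {s \<in> S. w s \<le> r} \<and> length ss \<le> nat \<lceil>r / \<delta>\<rceil>}"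
  proof safe
    fix ss assume ss: "set ss \<subseteq> S" "cost ss \<le> r"
    then show "w s \<le> r" if "s \<in> set ss" for s
      using weight_le_cost that by force
    have "real (length ss) * \<delta> \<le> r"
      using length_le_cost[OF \<delta>(2) ss(1)] ss(2) by simp
    then have "real (length ss) \<le> r / \<delta>"
      using \<delta>(1) by (simp add: field_simps)
    then show "length ss \<le> nat \<lceil>r / \<delta>\<rceil>"
      by linarith
  qed blast
  then show ?thesis
    by (rule finite_subset) (intro finite_lists_length_le finite_weight_le)
qed

text \<open>Symmetry of the generating set turns the inverses that generation allows into further
  letters.\<close>

lemma word_exists:
  assumes "x \<in> carrier G"
  obtains ss where "set ss \<subseteq> S" "x = word_prod ss"
proof -
  from assms have "x \<in> generate G S"
    by (simp add: S_generates)
  then have "\<exists>ss. set ss \<subseteq> S \<and> x = word_prod ss"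
  proof induction
    case one
    show ?case by (rule exI[of _ "[]"]) simp
  next
    case (incl h)
    then show ?case
      using S_carrier by (intro exI[of _ "[h]"]) auto
  next
    case (inv h)
    then show ?case
      using S_carrier inv_in_S by (intro exI[of _ "[inv h]"]) auto
  next
    case (eng h1 h2)
    then obtain ss ts where "set ss \<subseteq> S" "h1 = word_prod ss" "set ts \<subseteq> S" "h2 = word_prod ts"
      by blast
    then show ?case
      using S_carrier word_prod_append[of ss ts] by (intro exI[of _ "ss @ ts"]) auto
  qed
  then show thesis
    using that by blast
qed

abbreviation word_norm :: "'a \<Rightarrow> real" where
  "word_norm \<equiv> weighted_word_norm G S w"

lemma word_norm_le_cost:
  assumes "set ss \<subseteq> S"
  shows "word_norm (word_prod ss) \<le> cost ss"
  unfolding weighted_word_norm_def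
  using assms by (intro cInf_lower bdd_belowI[of _ 0]) (auto simp: cost_nonneg)

lemma word_norm_greatest:
  assumes "x \<in> carrier G"
    and "\<And>ss. set ss \<subseteq> S \<Longrightarrow> x = word_prod ss \<Longrightarrow> c \<le> cost ss"
  shows "c \<le> word_norm x"
  unfolding weighted_word_norm_def
proof (rule cInf_greatest)
  obtain ss where "set ss \<subseteq> S" "x = word_prod ss"
    using assms(1) by (rule word_exists)
  then show "{cost ss |ss. set ss \<subseteq> S \<and> x = word_prod ss} \<noteq> {}"
    by blast
  show "c \<le> k" if "k \<in> {cost ss |ss. set ss \<subseteq> S \<and> x = word_prod ss}" for k
    using that assms(2) by blast
qed

lemma word_norm_less_obtains_word:
  assumes "x \<in> carrier G" "word_norm x < c"
  obtains ss where "set ss \<subseteq> S" "x = word_prod ss" "cost ss < c"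
proof -
  have "\<exists>ss. set ss \<subseteq> S \<and> x = word_prod ss \<and> cost ss < c"
  proof (rule ccontr)
    assume "\<not> ?thesis"
    then have "c \<le> word_norm x"
      by (intro word_norm_greatest[OF assms(1)]) (auto simp: not_less)
    with assms(2) show False
      by linarith
  qed
  then show thesis
    using that by blast
qed

lemma word_norm_nonneg: "x \<in> carrier G \<Longrightarrow> 0 \<le> word_norm x"
  by (rule word_norm_greatest) (auto simp: cost_nonneg)

lemma word_norm_eq_0_iff:
  assumes "x \<in> carrier G"
  shows "word_norm x = 0 \<longleftrightarrow> x = \<one>"
proof
  obtain \<delta> where \<delta>: "\<delta> > 0" "\<And>s. s \<in> S \<Longrightarrow> \<delta> \<le> w s"
    using weight_bounded_below by blast
  assume "word_norm x = 0"
  with \<delta>(1) obtain ss where ss: "set ss \<subseteq> S" "x = word_prod ss" "cost ss < \<delta>"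
    using word_norm_less_obtains_word[OF assms, of \<delta>] by metis
  have "s \<notin> set ss" for s
    using ss \<delta>(2)[of s] weight_le_cost[of ss s] by auto
  then have "ss = []"
    by (cases ss) auto
  with ss(2) show "x = \<one>" by simp
next
  assume "x = \<one>"
  then show "word_norm x = 0"
    using word_norm_le_cost[of "[]"] word_norm_nonneg[of \<one>] by simp
qed

lemma word_norm_inv_le:
  assumes "x \<in> carrier G"
  shows "word_norm (inv x) \<le> word_norm x"
proof (rule word_norm_greatest[OF assms])
  fix ss assume ss: "set ss \<subseteq> S" "x = word_prod ss"
  let ?ts = "rev (map (m_inv G) ss)"
  have "inv x = word_prod ?ts"
    using ss S_carrier word_prod_rev_inv by auto
  moreover have "word_norm (word_prod ?ts) \<le> cost ?ts"
    using ss inv_in_S by (intro word_norm_le_cost) auto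
  moreover have "map w (map (m_inv G) ss) = map w ss"
    using ss weight_inv by auto
  then have "cost ?ts = cost ss"
    by (simp only: rev_map[symmetric] sum_list_rev)
  ultimately show "word_norm (inv x) \<le> cost ss"
    by simp
qed

lemma word_norm_inv:
  assumes "x \<in> carrier G"
  shows "word_norm (inv x) = word_norm x"
  using word_norm_inv_le[OF assms] word_norm_inv_le[of "inv x"] assms by simp

lemma word_norm_mult_le:
  assumes "x \<in> carrier G" "y \<in> carrier G"
  shows "word_norm (x \<otimes> y) \<le> word_norm x + word_norm y"
proof -
  \<comment> \<open>The two infima are taken one after the other, each with the other summand moved across.\<close>
  have "word_norm (x \<otimes> y) - word_norm y \<le> cost ss"
    if ss: "set ss \<subseteq> S" "x = word_prod ss" for ss
  proof -
    have "word_norm (x \<otimes> y) - cost ss \<le> word_norm y"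
    proof (rule word_norm_greatest[OF assms(2)])
      fix ts assume ts: "set ts \<subseteq> S" "y = word_prod ts"
      have "x \<otimes> y = word_prod (ss @ ts)"
        using ss ts S_carrier word_prod_append[of ss ts] by auto
      moreover have "word_norm (word_prod (ss @ ts)) \<le> cost (ss @ ts)"
        using ss ts by (intro word_norm_le_cost) auto
      ultimately show "word_norm (x \<otimes> y) - cost ss \<le> cost ts"
        by simp
    qed
    then show ?thesis by linarith
  qed
  then have "word_norm (x \<otimes> y) - word_norm y \<le> word_norm x"
    by (rule word_norm_greatest[OF assms(1)])
  then show ?thesis by linarith
qed

lemma group_norm_word_norm: "group_norm G word_norm"
  unfolding group_norm_def
  by (auto simp: word_norm_nonneg word_norm_eq_0_iff word_norm_inv word_norm_mult_le)

lemma finite_word_norm_balls: "finite {x \<in> carrier G. word_norm x \<le> r}"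
proof -
  \<comment> \<open>An infimum only yields words of cost below a strictly larger bound, hence the slack \<open>r + 1\<close>.\<close>
  have "{x \<in> carrier G. word_norm x \<le> r} \<subseteq> word_prod ` {ss. set ss \<subseteq> S \<and> cost ss \<le> r + 1}"
  proof
    fix x assume "x \<in> {x \<in> carrier G. word_norm x \<le> r}"
    then have x: "x \<in> carrier G" "word_norm x \<le> r"
      by simp_all
    then have "word_norm x < r + 1"
      by linarith
    with x(1) obtain ss where "set ss \<subseteq> S" "x = word_prod ss" "cost ss < r + 1"
      by (rule word_norm_less_obtains_word)
    then show "x \<in> word_prod ` {ss. set ss \<subseteq> S \<and> cost ss \<le> r + 1}"
      by auto
  qed
  then show ?thesis
    by (rule finite_surj[OF finite_words_cost_le])
qed

end

theorem proposition1p3: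
  fixes G :: "('a, 'b) monoid_scheme" and S :: "'a set" and w :: "'a \<Rightarrow> real"
  assumes "group G"
    and "countable (carrier G)"
    and "S \<subseteq> carrier G"
    and "set_inv\<^bsub>G\<^esub> S = S"
    and "generate G S = carrier G"
    and "weight_function G S w"
  shows "proper_group_norm G (weighted_word_norm G S w)"
proof -
  interpret weighted_group G S w
    using assms by (intro weighted_group.intro weighted_group_axioms.intro)
  show ?thesis
    by (rule proper_group_normI_finite_balls[OF group_norm_word_norm finite_word_norm_balls])
qed

end
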